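(* Let $k\leq n$ be non-negative integers and let $P^{k+1}_{n+1}$ be the set of all partitions of $n+1$ whose first (largest) part equals $k+1$. Then $$\binom{n}{k}_p=\sum_{\underline{\lambda}\in P^{k+1}_{n+1}}\ \prod_{i\geq 1}p^{(\lambda_1-\lambda_i)\lambda_{i+1}}\binom{\lambda_1-\lambda_{i+1}}{\lambda_1-\lambda_i}_p,$$ where each $\underline{\lambda}\in P^{k+1}_{n+1}$ is written as $\underline{\lambda}=(k+1=\lambda_1\geq \lambda_2\geq\cdots\geq\lambda_l)$ with positive parts, with the convention $\lambda_i=0$ for $i>l$.
   Context: Here $p$ is a prime (the identity may also be read as an identity of polynomials in $p$). The $p$-binomial coefficient is defined for integers $n,k\ge 0$ by $\binom{n}{k}_p=\frac{(p^n-1)(p^{n-1}-1)\cdots(p^{n-k+1}-1)}{(p^k-1)\cdots(p-1)}$ for $1\le k\le n$, $\binom{n}{0}_p=1$ for all $n\ge 0$, and $\binom{n}{k}_p=0$ if $k>n$. A partition of $N$ is a finite non-increasing sequence of positive integers summing to $N$. *)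

theory Defs
  imports
    Complex_Main
    "HOL-Computational_Algebra.Primes"
    "HOL-Library.Groups_Big_Fun"
    "HOL-Library.More_List"
begin

definition pbinom :: "rat \<Rightarrow> nat \<Rightarrow> nat \<Rightarrow> rat" where
  "pbinom p n k =
     (if k \<le> n then (\<Prod>i<k. p ^ (n - i) - 1) / (\<Prod>i<k. p ^ (k - i) - 1) else 0)"

definition is_partition :: "nat \<Rightarrow> nat list \<Rightarrow> bool" where
  "is_partition N \<mu> \<longleftrightarrow> sorted_wrt (\<ge>) \<mu> \<and> (\<forall>x\<in>set \<mu>. 0 < x) \<and> sum_list \<mu> = N"

(* Parts are numbered from 1, lists from 0; only indices i >= 1 are meaningful. *)
definition part :: "nat list \<Rightarrow> nat \<Rightarrow> nat" where
  "part \<mu> i = nth_default 0 \<mu> (i - 1)"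

definition partitions_with_first :: "nat \<Rightarrow> nat \<Rightarrow> nat list set" where
  "partitions_with_first N m = {\<mu>. is_partition N \<mu> \<and> part \<mu> 1 = m}"

lemma length_le_sum_list: "\<forall>x\<in>set \<mu>. 0 < x \<Longrightarrow> length \<mu> \<le> sum_list (\<mu> :: nat list)"
  by (induction \<mu>) auto

lemma finite_partitions_with_first: "finite (partitions_with_first N m)"
proof (rule finite_subset)
  show "partitions_with_first N m \<subseteq> {\<mu>. set \<mu> \<subseteq> {..N} \<and> length \<mu> \<le> N}"
    using member_le_sum_list length_le_sum_list
    by (fastforce simp: partitions_with_first_def is_partition_def)
qed (simp add: finite_lists_length_le)

(* The natural-number subtractions in the definition of factor below do not truncate. *)
lemma part_le_part_1: "is_partition N \<mu> \<Longrightarrow> part \<mu> i \<le> part \<mu> 1"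
  by (cases \<mu>) (auto simp: part_def is_partition_def nth_default_def nth_Cons split: nat.splits)

definition factor :: "rat \<Rightarrow> nat list \<Rightarrow> nat \<Rightarrow> rat" where
  "factor p \<mu> i =
     p ^ ((part \<mu> 1 - part \<mu> i) * part \<mu> (i + 1)) *
     pbinom p (part \<mu> 1 - part \<mu> (i + 1)) (part \<mu> 1 - part \<mu> i)"

lemma pbinom_self:
  assumes "p > 1"
  shows "pbinom p n n = 1"
proof -
  have "p ^ (n - i) > 1" if "i < n" for i
    using assms that by (intro one_less_power) auto
  then have "p ^ (n - i) - 1 \<noteq> 0" if "i < n" for i
    using that by fastforce
  then have "(\<Prod>i<n. p ^ (n - i) - 1) \<noteq> 0"
    by simp
  then show ?thesis
    by (simp add: pbinom_def)
qed

lemma factor_beyond_length: "p > 1 \<Longrightarrow> length \<mu> < i \<Longrightarrow> factor p \<mu> i = 1"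
  by (simp add: factor_def part_def nth_default_beyond pbinom_self)

(* Prod_any is 1 by convention for a product with infinitely many nontrivial factors;
   this lemma shows that the convention is not used. The index is shifted so that
   i + 1 ranges over the positive integers. *)
lemma Prod_any_factor:
  assumes "p > 1"
  shows "finite {i. factor p \<mu> (i + 1) \<noteq> 1}"
    and "(\<Prod>i. factor p \<mu> (i + 1)) = (\<Prod>i=1..length \<mu>. factor p \<mu> i)"
proof -
  have sub: "{i. factor p \<mu> (i + 1) \<noteq> 1} \<subseteq> {..<length \<mu>}"
  proof
    fix i
    assume "i \<in> {i. factor p \<mu> (i + 1) \<noteq> 1}"
    then show "i \<in> {..<length \<mu>}"
      using factor_beyond_length[OF assms, of \<mu> "i + 1"] by (cases "i < length \<mu>") auto
  qed
  then show "finite {i. factor p \<mu> (i + 1) \<noteq> 1}"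
    by (rule finite_subset) simp
  have "(\<Prod>i. factor p \<mu> (i + 1)) = (\<Prod>i<length \<mu>. factor p \<mu> (i + 1))"
    using sub by (intro Prod_any.expand_superset) auto
  also have "\<dots> = (\<Prod>i=1..length \<mu>. factor p \<mu> i)"
    by (rule prod.reindex_bij_witness[of _ "\<lambda>i. i - 1" "\<lambda>i. i + 1"]) auto
  finally show "(\<Prod>i. factor p \<mu> (i + 1)) = (\<Prod>i=1..length \<mu>. factor p \<mu> i)" .
qed

end

theory Submission
  imports Defs
begin

text \<open>
  Fix \<open>m = k + 1\<close> and peel off the parts of the partition one at a time. If the part just removed
  is \<open>a\<close>, the weighted sum over the partitions of \<open>N\<close> that can still follow it has the closed form
  \<open>binom(m, m - a) p^((m - a) N) binom(N + a - 1, N)\<close>. This follows by strong induction on \<open>N\<close>,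
  splitting off the next part \<open>b\<close>: after the trinomial revision
  \<open>binom(m, m - b) binom(m - b, m - a) = binom(m, m - a) binom(a, b)\<close>, the sum over \<open>b\<close> is an
  instance of the \<open>q\<close>-Vandermonde identity. The theorem is the case \<open>a = m\<close>, \<open>N = n - k\<close>.
\<close>

section \<open>Gaussian binomial coefficients\<close>

text \<open>This is \<open>(p - 1) ^ n\<close> times the usual \<open>p\<close>-factorial; the
  powers of \<open>p - 1\<close> cancel in the quotient of \<open>pbinom_pfact\<close>.\<close>

definition pfact :: "rat \<Rightarrow> nat \<Rightarrow> rat" where
  "pfact p n = (\<Prod>i<n. p ^ Suc i - 1)"

lemma pfact_0 [simp]: "pfact p 0 = 1"
  by (simp add: pfact_def)

lemma pfact_Suc: "pfact p (Suc n) = (p ^ Suc n - 1) * pfact p n"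
  by (simp add: pfact_def mult.commute)

lemma pfact_nonzero:
  assumes "p > 1"
  shows "pfact p n \<noteq> 0"
proof -
  have "p ^ Suc i \<noteq> 1" for i
    using one_less_power[OF assms, of "Suc i"] by simp
  then show ?thesis
    by (simp add: pfact_def)
qed

lemma prod_falling_pfact:
  "k \<le> n \<Longrightarrow> (\<Prod>i<k. p ^ (n - i) - 1) * pfact p (n - k) = pfact p n"
proof (induction k)
  case (Suc k)
  then have "pfact p (n - k) = (p ^ (n - k) - 1) * pfact p (n - Suc k)"
    by (metis Suc_diff_Suc Suc_le_lessD pfact_Suc)
  with Suc show ?case
    by (simp add: mult.assoc)
qed simp

lemma pbinom_pfact:
  assumes "p > 1" "k \<le> n"
  shows "pbinom p n k = pfact p n / (pfact p k * pfact p (n - k))"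
proof -
  have "(\<Prod>i<k. p ^ (k - i) - 1) = pfact p k"
    using prod_falling_pfact[of k k p] by simp
  moreover have "(\<Prod>i<k. p ^ (n - i) - 1) = pfact p n / pfact p (n - k)"
    using prod_falling_pfact[OF assms(2), of p] pfact_nonzero[OF assms(1)]
    by (simp add: eq_divide_eq)
  ultimately show ?thesis
    using assms(2) by (simp add: pbinom_def)
qed

lemma pbinom_0_right [simp]: "pbinom p n 0 = 1"
  by (simp add: pbinom_def)

lemma pbinom_eq_0: "n < k \<Longrightarrow> pbinom p n k = 0"
  by (simp add: pbinom_def)

lemma pbinom_symmetric:
  assumes "p > 1" "k \<le> n"
  shows "pbinom p n (n - k) = pbinom p n k"
  using assms by (simp add: pbinom_pfact mult.commute)

text \<open>With \<open>K = p ^ (k + 1)\<close> and \<open>J = p ^ (n - k)\<close>, putting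
  everything over a common denominator when \<open>k < n\<close> leaves K J - 1 = (K - 1) + K (J -
  1).\<close>

lemma pbinom_Suc_Suc:
  assumes "p > 1"
  shows "pbinom p (Suc n) (Suc k) = pbinom p n k + p ^ Suc k * pbinom p n (Suc k)"
proof (cases n k rule: linorder_cases)
  case less
  then show ?thesis by (simp add: pbinom_eq_0)
next
  case equal
  then show ?thesis
    using assms by (simp add: pbinom_eq_0 pbinom_self)
next
  case greater
  then obtain j where n: "n = Suc (k + j)"
    using less_imp_Suc_add by blast
  have nz: "pfact p k \<noteq> 0" "pfact p j \<noteq> 0" "p ^ Suc k - 1 \<noteq> 0" "p ^ Suc j - 1 \<noteq> 0"
    using pfact_nonzero[OF assms] one_less_power[OF assms, of "Suc k"]
      one_less_power[OF assms, of "Suc j"] by auto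
  define K where "K = p ^ Suc k"
  define J where "J = p ^ Suc j"
  have KJ: "p ^ Suc n = K * J"
    by (simp add: n K_def J_def power_add)
  have nz': "K - 1 \<noteq> 0" "J - 1 \<noteq> 0"
    using nz by (simp_all add: K_def J_def)
  have "pbinom p (Suc n) (Suc k)
      = (K * J - 1) * pfact p n / ((K - 1) * pfact p k * ((J - 1) * pfact p j))"
    using assms by (simp add: pbinom_pfact n pfact_Suc[of p k] pfact_Suc[of p j]
        pfact_Suc[of p "Suc (k + j)"] KJ[unfolded n] K_def[symmetric] J_def[symmetric]
        del: power_Suc)
  moreover have "pbinom p n k = pfact p n / (pfact p k * ((J - 1) * pfact p j))"
    using assms by (simp add: pbinom_pfact n pfact_Suc[of p j] Suc_diff_le
        J_def[symmetric] del: power_Suc)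
  moreover have "pbinom p n (Suc k) = pfact p n / ((K - 1) * pfact p k * pfact p j)"
    using assms by (simp add: pbinom_pfact n pfact_Suc[of p k] K_def[symmetric] del: power_Suc)
  \<comment> \<open>Taking \<open>u = K - 1\<close> and \<open>v = J - 1\<close> as the variables
    makes every denominator a product of atoms known to be nonzero.\<close>
  moreover have "((u + 1) * (v + 1) - 1) * x / (u * a * (v * b))
      = x / (a * (v * b)) + (u + 1) * (x / (u * a * b))"
    if "u \<noteq> 0" "v \<noteq> 0" "a \<noteq> 0" "b \<noteq> 0" for u v a b x :: rat
    using that by (simp add: field_simps)
  from this[OF nz' nz(1,2), of "pfact p n"]
  have "(K * J - 1) * pfact p n / ((K - 1) * pfact p k * ((J - 1) * pfact p j))
      = pfact p n / (pfact p k * ((J - 1) * pfact p j))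
        + K * (pfact p n / ((K - 1) * pfact p k * pfact p j))"
    by simp
  ultimately show ?thesis
    unfolding K_def[symmetric] by simp
qed

text \<open>Both sides equal the multinomial quotient
  \<open>pfact p m / (pfact p b * pfact p (a - b) * pfact p (m - a))\<close>.\<close>

lemma pbinom_trinomial_revision:
  assumes "p > 1" "b \<le> a" "a \<le> m"
  shows "pbinom p m (m - b) * pbinom p (m - b) (m - a) = pbinom p m (m - a) * pbinom p a b"
  using assms pfact_nonzero[OF assms(1)] by (simp add: pbinom_pfact field_simps)

text \<open>Induction on \<open>m\<close> with \<open>n\<close> fixed: Pascal's rule is applied to
  the first factor of each summand and to the right-hand side.\<close>

lemma pbinom_Vandermonde:
  assumes "p > 1"
  shows "(\<Sum>b\<le>N. pbinom p m b * pbinom p n (N - b) * p ^ ((m - b) * (N - b))) = pbinom p (m + n) N"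
proof (induction m arbitrary: N)
  case 0
  have "(\<Sum>b\<le>N. pbinom p 0 b * pbinom p n (N - b) * p ^ ((0 - b) * (N - b)))
      = (\<Sum>b\<in>{0}. pbinom p 0 b * pbinom p n (N - b) * p ^ ((0 - b) * (N - b)))"
    by (rule sum.mono_neutral_right) (auto simp: pbinom_eq_0)
  then show ?case by simp
next
  case (Suc m)
  show ?case
  proof (cases N)
    case 0
    then show ?thesis by simp
  next
    case (Suc M)
    let ?t = "\<lambda>m N b. pbinom p m b * pbinom p n (N - b) * p ^ ((m - b) * (N - b))"
    \<comment> \<open>The factor \<open>p ^ Suc b\<close> from Pascal's rule combines with the old
      power into \<open>p ^ N\<close>, which is independent of \<open>b\<close>. For
      \<open>m < Suc b\<close>, where the subtraction truncates, the second term is zero.\<close>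
    have step: "?t (Suc m) N (Suc b) = ?t m M b + p ^ N * ?t m N (Suc b)" if "b \<le> M" for b
    proof (cases "Suc b \<le> m")
      case True
      then have "N + (m - Suc b) * (N - Suc b) = Suc b + (Suc m - Suc b) * (N - Suc b)"
        using that Suc by (simp add: Suc_diff_Suc[symmetric, of b m])
      then have "p ^ N * p ^ ((m - Suc b) * (N - Suc b))
          = p ^ Suc b * p ^ ((Suc m - Suc b) * (N - Suc b))"
        by (metis power_add)
      moreover have "?t (Suc m) N (Suc b) = ?t m M b +
          pbinom p m (Suc b) * pbinom p n (N - Suc b) *
            (p ^ Suc b * p ^ ((Suc m - Suc b) * (N - Suc b)))"
        using Suc by (simp add: pbinom_Suc_Suc[OF assms] algebra_simps del: power_Suc)
      ultimately show ?thesis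
        by (simp add: mult_ac)
    next
      case False
      then show ?thesis
        using Suc by (simp add: pbinom_Suc_Suc[OF assms] pbinom_eq_0)
    qed
    have "(\<Sum>b\<le>N. ?t (Suc m) N b) = ?t (Suc m) N 0 + (\<Sum>b\<le>M. ?t (Suc m) N (Suc b))"
      unfolding Suc by (rule sum.atMost_Suc_shift)
    also have "(\<Sum>b\<le>M. ?t (Suc m) N (Suc b))
        = (\<Sum>b\<le>M. ?t m M b) + p ^ N * (\<Sum>b\<le>M. ?t m N (Suc b))"
      unfolding sum_distrib_left sum.distrib[symmetric] by (rule sum.cong) (use step in auto)
    also have "?t (Suc m) N 0 = p ^ N * ?t m N 0"
      by (simp add: power_add)
    also have "p ^ N * ?t m N 0 + ((\<Sum>b\<le>M. ?t m M b) + p ^ N * (\<Sum>b\<le>M. ?t m N (Suc b)))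
        = (\<Sum>b\<le>M. ?t m M b) + p ^ N * (?t m N 0 + (\<Sum>b\<le>M. ?t m N (Suc b)))"
      by (simp only: algebra_simps)
    also have "?t m N 0 + (\<Sum>b\<le>M. ?t m N (Suc b)) = (\<Sum>b\<le>N. ?t m N b)"
      unfolding Suc by (rule sum.atMost_Suc_shift[symmetric])
    also have "(\<Sum>b\<le>M. ?t m M b) + p ^ N * (\<Sum>b\<le>N. ?t m N b) = pbinom p (Suc m + n) N"
      unfolding Suc.IH by (simp add: \<open>N = Suc M\<close> pbinom_Suc_Suc[OF assms])
    finally show ?thesis .
  qed
qed

section \<open>Peeling off the parts of a partition\<close>

definition bounded_partitions :: "nat \<Rightarrow> nat \<Rightarrow> nat list set" where
  "bounded_partitions N a = {\<nu>. is_partition N \<nu> \<and> (\<forall>x\<in>set \<nu>. x \<le> a)}"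

lemma bounded_partitions_0: "bounded_partitions 0 a = {[]}"
  by (auto simp: bounded_partitions_def is_partition_def) (metis list.set_intros(1) neq_Nil_conv less_irrefl)

text \<open>The split is by the first part \<open>b\<close>, which bounds all later ones. Since
  \<open>b\<close> is at least 1, the remainder \<open>N - b\<close> is smaller than
  \<open>N\<close>, so strong induction applies.\<close>

lemma bounded_partitions_pos:
  assumes "N > 0"
  shows "bounded_partitions N a = (\<Union>b\<in>{1..min a N}. (#) b ` bounded_partitions (N - b) b)"
proof (intro equalityI subsetI)
  fix \<nu> assume "\<nu> \<in> bounded_partitions N a"
  moreover from this assms obtain b \<nu>' where "\<nu> = b # \<nu>'"
    by (cases \<nu>) (auto simp: bounded_partitions_def is_partition_def)
  ultimately show "\<nu> \<in> (\<Union>b\<in>{1..min a N}. (#) b ` bounded_partitions (N - b) b)"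
    by (intro UN_I[of b]) (auto simp: bounded_partitions_def is_partition_def)
next
  fix \<nu> assume "\<nu> \<in> (\<Union>b\<in>{1..min a N}. (#) b ` bounded_partitions (N - b) b)"
  then show "\<nu> \<in> bounded_partitions N a"
    by (fastforce simp: bounded_partitions_def is_partition_def)
qed

lemma finite_bounded_partitions: "finite (bounded_partitions N a)"
proof (induction N arbitrary: a rule: less_induct)
  case (less N)
  then show ?case
    by (cases "N = 0") (auto simp: bounded_partitions_0 bounded_partitions_pos)
qed

lemma partitions_with_first_eq:
  assumes "0 < m" "m \<le> N"
  shows "partitions_with_first N m = (#) m ` bounded_partitions (N - m) m"
proof (intro equalityI subsetI)
  fix \<mu> assume "\<mu> \<in> partitions_with_first N m"
  with assms show "\<mu> \<in> (#) m ` bounded_partitions (N - m) m"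
    by (cases \<mu>) (auto simp: partitions_with_first_def bounded_partitions_def is_partition_def part_def)
next
  fix \<mu> assume "\<mu> \<in> (#) m ` bounded_partitions (N - m) m"
  with assms show "\<mu> \<in> partitions_with_first N m"
    by (auto simp: partitions_with_first_def bounded_partitions_def is_partition_def part_def)
qed

text \<open>The product of the factors contributed by a part \<open>a\<close> and the parts \<open>\<nu>\<close> after it, where \<open>m\<close>
  is the largest part of the whole partition.\<close>

fun tail_weight :: "rat \<Rightarrow> nat \<Rightarrow> nat \<Rightarrow> nat list \<Rightarrow> rat" where
  "tail_weight p m a [] = pbinom p m (m - a)"
| "tail_weight p m a (b # \<nu>) = p ^ ((m - a) * b) * pbinom p (m - b) (m - a) * tail_weight p m b \<nu>"

text \<open>The last index is \<open>length \<nu>\<close>: there the next part is the default 0, the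
  power of \<open>p\<close> is 1, and the factor is the value of \<open>tail_weight\<close> at
  \<open>[]\<close>.\<close>

lemma tail_weight_eq_prod:
  "tail_weight p m a \<nu> =
    (\<Prod>i\<le>length \<nu>. p ^ ((m - nth_default 0 (a # \<nu>) i) * nth_default 0 (a # \<nu>) (Suc i)) *
      pbinom p (m - nth_default 0 (a # \<nu>) (Suc i)) (m - nth_default 0 (a # \<nu>) i))"
proof (induction \<nu> arbitrary: a)
  case (Cons b \<nu>)
  show ?case
    unfolding tail_weight.simps Cons list.size add_0_right add_Suc_right prod.atMost_Suc_shift by simp
qed simp

lemma Prod_any_factor_Cons:
  assumes "p > 1"
  shows "(\<Prod>i. factor p (m # \<nu>) (i + 1)) = tail_weight p m m \<nu>"
proof -
  have "(\<Prod>i. factor p (m # \<nu>) (i + 1)) = (\<Prod>i=1..length (m # \<nu>). factor p (m # \<nu>) i)"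
    by (rule Prod_any_factor(2)[OF assms])
  also have "\<dots> = (\<Prod>i\<le>length \<nu>. factor p (m # \<nu>) (Suc i))"
    by (rule prod.reindex_bij_witness[of _ Suc "\<lambda>i. i - 1"]) auto
  also have "\<dots> = tail_weight p m m \<nu>"
    by (simp add: tail_weight_eq_prod factor_def part_def)
  finally show ?thesis .
qed

text \<open>The formula covers \<open>a = 0\<close> as well: for positive \<open>N\<close> the set
  is empty and \<open>pbinom p (N - 1) N\<close> is zero.\<close>

lemma sum_tail_weight:
  assumes p: "p > 1" and "a \<le> m"
  shows "(\<Sum>\<nu>\<in>bounded_partitions N a. tail_weight p m a \<nu>)
    = pbinom p m (m - a) * p ^ ((m - a) * N) * pbinom p (a + N - 1) N"
  using \<open>a \<le> m\<close>
proof (induction N arbitrary: a rule: less_induct)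
  case (less N)
  show ?case
  proof (cases "N = 0")
    case True
    then show ?thesis by (simp add: bounded_partitions_0)
  next
    case False
    \<comment> \<open>The upper index \<open>N - 1\<close> is \<open>b + (N - b) - 1\<close> from
      the induction hypothesis. It does not depend on \<open>b\<close>, so \<open>?v\<close> is a
      Vandermonde summand.\<close>
    let ?v = "\<lambda>b. pbinom p a b * pbinom p (N - 1) (N - b) * p ^ ((a - b) * (N - b))"
    let ?C = "pbinom p m (m - a) * p ^ ((m - a) * N)"
    have inner: "(\<Sum>\<nu>\<in>(#) b ` bounded_partitions (N - b) b. tail_weight p m a \<nu>) = ?C * ?v b"
      if "b \<in> {1..min a N}" for b
    proof -
      from that have b: "1 \<le> b" "b \<le> a" "b \<le> N" by auto
      have "(\<Sum>\<nu>\<in>(#) b ` bounded_partitions (N - b) b. tail_weight p m a \<nu>)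
          = p ^ ((m - a) * b) * pbinom p (m - b) (m - a) *
            (\<Sum>\<nu>\<in>bounded_partitions (N - b) b. tail_weight p m b \<nu>)"
        by (simp add: sum.reindex sum_distrib_left)
      also have "(\<Sum>\<nu>\<in>bounded_partitions (N - b) b. tail_weight p m b \<nu>)
          = pbinom p m (m - b) * p ^ ((m - b) * (N - b)) * pbinom p (N - 1) (N - b)"
        using less.IH[of "N - b" b] b less.prems False by simp
      also have "p ^ ((m - a) * b) * pbinom p (m - b) (m - a) * \<dots>
          = (pbinom p m (m - b) * pbinom p (m - b) (m - a)) *
            p ^ ((m - a) * b + (m - b) * (N - b)) * pbinom p (N - 1) (N - b)"
        by (simp add: power_add)
      also have "pbinom p m (m - b) * pbinom p (m - b) (m - a) = pbinom p m (m - a) * pbinom p a b"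
        using pbinom_trinomial_revision p b less.prems by simp
      \<comment> \<open>This isolates the part of the exponent that is independent of
        \<open>b\<close>, which goes into \<open>?C\<close>.\<close>
      also have "(m - a) * b + (m - b) * (N - b) = (m - a) * N + (a - b) * (N - b)"
      proof -
        have "m - b = (m - a) + (a - b)" "N = b + (N - b)"
          using b less.prems by auto
        then show ?thesis
          by (metis add.assoc distrib_left distrib_right)
      qed
      finally show ?thesis
        by (simp add: power_add)
    qed
    have "(\<Sum>\<nu>\<in>bounded_partitions N a. tail_weight p m a \<nu>)
        = (\<Sum>b\<in>{1..min a N}. \<Sum>\<nu>\<in>(#) b ` bounded_partitions (N - b) b. tail_weight p m a \<nu>)"
      unfolding bounded_partitions_pos[OF False[unfolded neq0_conv]]
      by (rule sum.UNION_disjoint) (auto simp: finite_bounded_partitions)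
    also have "\<dots> = (\<Sum>b\<in>{1..min a N}. ?C * ?v b)"
      by (rule sum.cong) (use inner in auto)
    \<comment> \<open>The added terms vanish: \<open>pbinom p (N - 1) N\<close> is zero at
      \<open>b = 0\<close>, and \<open>pbinom p a b\<close> is zero for
      \<open>b > a\<close>.\<close>
    also have "\<dots> = (\<Sum>b\<le>N. ?C * ?v b)"
    proof (rule sum.mono_neutral_left)
      show "\<forall>b\<in>{..N} - {1..min a N}. ?C * ?v b = 0"
      proof
        fix b assume "b \<in> {..N} - {1..min a N}"
        then have "b = 0 \<or> a < b" by auto
        then show "?C * ?v b = 0"
          using False by (auto simp: pbinom_eq_0)
      qed
    qed auto
    also have "\<dots> = ?C * pbinom p (a + (N - 1)) N"
      unfolding sum_distrib_left[symmetric] pbinom_Vandermonde[OF p] ..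
    finally show ?thesis
      using False by simp
  qed
qed

theorem theorem1p10:
  fixes p k n :: nat
  assumes "prime p" and "k \<le> n"
  shows "pbinom (of_nat p) n k =
    (\<Sum>\<mu>\<in>partitions_with_first (n + 1) (k + 1). \<Prod>i. factor (of_nat p) \<mu> (i + 1))"
proof -
  have p: "(of_nat p :: rat) > 1"
    using prime_gt_1_nat[OF assms(1)] by simp
  have "(\<Sum>\<mu>\<in>partitions_with_first (n + 1) (k + 1). \<Prod>i. factor (of_nat p) \<mu> (i + 1))
      = (\<Sum>\<nu>\<in>bounded_partitions (n - k) (k + 1). tail_weight (of_nat p) (k + 1) (k + 1) \<nu>)"
    using assms(2) p
    by (subst partitions_with_first_eq) (simp_all add: sum.reindex Prod_any_factor_Cons[simplified])
  \<comment> \<open>Here \<open>m - a = 0\<close> removes the prefactors, and the upper index is (k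
    + 1) + (n - k) - 1 = n.\<close>
  also have "\<dots> = pbinom (of_nat p) n (n - k)"
    using assms(2) p by (subst sum_tail_weight) auto
  finally show ?thesis
    using pbinom_symmetric[OF p assms(2)] by simp
qed

end
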